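(* Let $T$ be a tree with $n$ vertices and let $m$ be an integer with $1<m<n$. Then, as $k\to\infty$, \[ P_m(T,k)=k^n - \sum_{v\in V(T)}\binom{d(v)}{m}k^{n-m} + o(k^{n-m}), \] where $d(v)$ denotes the degree of the vertex $v$ in $T$.
   Context: For a finite graph $G$ and positive integers $m,k$, the $m$-chromatic (degree chromatic) polynomial $P_m(G,k)$ is the number of colorings $V(G)\to\{1,\dots,k\}$ (not necessarily proper) such that no vertex has $m$ (or more) adjacent vertices of its same color. This count is a polynomial in $k$. For $m=1$ it is the usual chromatic polynomial. *)

theory Defs
  imports "HOL-Library.Landau_Symbols" "HOL-Library.FuncSet" "Graph_Theory.Digraph_Component"
begin

text \<open>
  A finite simple graph is represented, following \<^locale>\<open>graph\<close>, by a finite loop-free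
  symmetric digraph without parallel arcs: each edge is a pair of opposite arcs.
  The predicate \<^const>\<open>tree\<close> is unsuitable here, since it counts \<open>u, v, u\<close> as a cycle and is
  therefore false for every symmetric digraph with at least one edge.  Cycles of a simple graph
  are the cycles of length at least 3.
\<close>

definition undirected_tree :: "('a, 'b) pre_digraph \<Rightarrow> bool" where
  "undirected_tree G \<longleftrightarrow> graph G \<and> Digraph_Component.connected G
     \<and> \<not> (\<exists>p. pre_digraph.cycle G p \<and> 3 \<le> length p)"

definition neighbours :: "('a, 'b) pre_digraph \<Rightarrow> 'a \<Rightarrow> 'a set" where
  "neighbours G v = {w \<in> verts G. v \<rightarrow>\<^bsub>G\<^esub> w}"

definition degree :: "('a, 'b) pre_digraph \<Rightarrow> 'a \<Rightarrow> nat" where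
  "degree G v = card (neighbours G v)"

text \<open>
  Colourings are extensional functions on the vertex set, so each one is counted exactly once.
\<close>

definition degree_colourings :: "nat \<Rightarrow> ('a, 'b) pre_digraph \<Rightarrow> nat \<Rightarrow> ('a \<Rightarrow> nat) set" where
  "degree_colourings m G k =
     {c \<in> verts G \<rightarrow>\<^sub>E {1..k}. \<not> (\<exists>v \<in> verts G. m \<le> card {w \<in> neighbours G v. c w = c v})}"

definition degree_chromatic :: "nat \<Rightarrow> ('a, 'b) pre_digraph \<Rightarrow> nat \<Rightarrow> nat" where
  "degree_chromatic m G k = card (degree_colourings m G k)"

end

(* In each colouring not counted by P_m, some closed star, consisting of a vertex v and
   m of its neighbours, is monochromatic.  A fixed star with m + 1 vertices is monochromatic in
   k^(n - m) colourings.  Since a tree has no triangle and m > 1, a star is determined by its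
   vertex set, so two different stars impose constraints that are met by at most k^(n - m - 1)
   colourings.  The Bonferroni inequalities give the claim. *)
theory Submission
  imports Defs
begin

section \<open>Truncated inclusion-exclusion\<close>

text \<open>Second Bonferroni inequality with a crude count of pairs. Inserting a set adds an
  overlap of at most \<open>card I * b\<close> with the earlier union, and
  \<open>card I + (card I)\<^sup>2\<close> is at most the square of
  \<open>card I + 1\<close>.\<close>

lemma sum_card_le_card_UN:
  assumes "finite I" and "\<And>i. i \<in> I \<Longrightarrow> finite (A i)"
    and "\<And>i j. i \<in> I \<Longrightarrow> j \<in> I \<Longrightarrow> i \<noteq> j \<Longrightarrow> card (A i \<inter> A j) \<le> b"
  shows "(\<Sum>i\<in>I. card (A i)) \<le> card (\<Union>i\<in>I. A i) + (card I)\<^sup>2 * b"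
  using assms
proof (induction I)
  case (insert x I)
  have "card (A x \<inter> (\<Union>i\<in>I. A i)) \<le> (\<Sum>i\<in>I. card (A x \<inter> A i))"
    using card_UN_le[OF \<open>finite I\<close>, of "\<lambda>i. A x \<inter> A i"] by simp
  also have "\<dots> \<le> card I * b"
    using sum_bounded_above[of I "\<lambda>i. card (A x \<inter> A i)" b] insert.hyps(2) insert.prems(2)
    by fastforce
  finally have *: "card (A x \<inter> (\<Union>i\<in>I. A i)) \<le> card I * b" .
  have "card (A x) + card (\<Union>i\<in>I. A i) =
      card (A x \<union> (\<Union>i\<in>I. A i)) + card (A x \<inter> (\<Union>i\<in>I. A i))"
    using insert by (intro card_Un_Int) auto
  moreover have "(\<Sum>i\<in>I. card (A i)) \<le> card (\<Union>i\<in>I. A i) + (card I)\<^sup>2 * b"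
    using insert by auto
  ultimately show ?case
    using * insert.hyps by (simp add: power2_eq_square algebra_simps)
qed simp

section \<open>Colourings constant on one or two given vertex sets\<close>

definition monochromatic :: "'a set \<Rightarrow> 'c set \<Rightarrow> 'a set \<Rightarrow> ('a \<Rightarrow> 'c) set" where
  "monochromatic V C X = {c \<in> V \<rightarrow>\<^sub>E C. \<forall>x\<in>X. \<forall>y\<in>X. c x = c y}"

lemma finite_monochromatic:
  "finite V \<Longrightarrow> finite C \<Longrightarrow> finite (monochromatic V C X)"
  by (simp add: monochromatic_def finite_PiE)

text \<open>Such a colouring amounts to free choices on \<open>V - X\<close> and at one
  representative \<open>x\<close> of \<open>X\<close>. The set \<open>D\<close> collects these
  vertices.\<close>

lemma card_monochromatic:
  assumes V: "finite V" and X: "X \<subseteq> V" "card X = Suc m"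
  shows "card (monochromatic V C X) = card C ^ (card V - m)"
proof -
  obtain x where x: "x \<in> X" using X(2) by fastforce
  define D where "D = insert x (V - X)"
  have fX: "finite X" using V X(1) by (rule rev_finite_subset)
  \<comment> \<open>Guards the truncated subtraction: with it, \<open>Suc (card V - Suc m)\<close>
    equals \<open>card V - m\<close>.\<close>
  have le: "Suc m \<le> card V" using card_mono[OF V X(1)] X(2) by simp
  have D: "D \<subseteq> V" "finite D" "card D = card V - m"
    using V X x fX le by (auto simp: D_def card_Diff_subset)
  have "bij_betw (\<lambda>c. restrict c D) (monochromatic V C X) (D \<rightarrow>\<^sub>E C)"
  proof (rule bij_betwI[where g = "\<lambda>d. \<lambda>v\<in>V. d (if v \<in> X then x else v)"])
    show "(\<lambda>c. restrict c D) \<in> monochromatic V C X \<rightarrow> (D \<rightarrow>\<^sub>E C)"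
      using D(1) by (auto simp: monochromatic_def PiE_iff)
    show "(\<lambda>d. \<lambda>v\<in>V. d (if v \<in> X then x else v)) \<in> (D \<rightarrow>\<^sub>E C) \<rightarrow> monochromatic V C X"
    proof
      fix d
      assume d: "d \<in> D \<rightarrow>\<^sub>E C"
      have "d (if v \<in> X then x else v) \<in> C" if "v \<in> V" for v
        using that by (intro PiE_mem[OF d]) (simp add: D_def)
      then show "(\<lambda>v\<in>V. d (if v \<in> X then x else v)) \<in> monochromatic V C X"
        using X(1) by (simp add: monochromatic_def subset_iff)
    qed
    show "(\<lambda>v\<in>V. restrict c D (if v \<in> X then x else v)) = c" if "c \<in> monochromatic V C X" for c
    proof
      have const: "\<And>v. v \<in> X \<Longrightarrow> c v = c x" and ext: "c \<in> extensional V"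
        using that x unfolding monochromatic_def PiE_def by blast+
      \<comment> \<open>Three cases: on \<open>X\<close> both sides are \<open>c x\<close>; on
        \<open>V - X\<close> the vertex lies in \<open>D\<close>; outside \<open>V\<close> both are
        \<open>undefined\<close> by extensionality.\<close>
      show "(\<lambda>v\<in>V. restrict c D (if v \<in> X then x else v)) v = c v" for v
        using const[of v] extensional_arb[OF ext, of v] by (simp add: D_def)
    qed
    show "restrict (\<lambda>v\<in>V. d (if v \<in> X then x else v)) D = d" if "d \<in> D \<rightarrow>\<^sub>E C" for d
    proof
      show "restrict (\<lambda>v\<in>V. d (if v \<in> X then x else v)) D v = d v" for v
        using PiE_arb[OF that, of v] D(1) by (auto simp: D_def)
    qed
  qed
  then have "card (monochromatic V C X) = card (D \<rightarrow>\<^sub>E C)" by (rule bij_betw_same_card)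
  then show ?thesis using D by (simp add: card_PiE)
qed

lemma card_monochromatic_Int_le:
  assumes V: "finite V" and C: "finite C"
    and X: "X \<subseteq> V" "card X = Suc m" and Y: "Y \<subseteq> V" "card Y = Suc m"
    and "X \<noteq> Y" and "0 < m"
  shows "card (monochromatic V C X \<inter> monochromatic V C Y) \<le> card C ^ (card V - Suc m)"
proof -
  obtain x where x: "x \<in> X" using X(2) by fastforce
  have fin: "finite X" "finite Y" using V X(1) Y(1) by (auto intro: finite_subset)
  \<comment> \<open>Two different finite sets of equal size cannot be nested.\<close>
  obtain y where y: "y \<in> Y" "y \<notin> X"
    using card_subset_eq[of X Y] fin X(2) Y(2) \<open>X \<noteq> Y\<close> by auto
  \<comment> \<open>As m > 0, the set \<open>Y\<close> has a second element to pass its colour on to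
    \<open>y\<close>.\<close>
  obtain z where z: "z \<in> Y" "z \<noteq> y"
    using card_le_Suc0_iff_eq[OF fin(2)] Y(2) \<open>0 < m\<close> y(1) by auto
  text \<open>A colouring that is constant on both sets is determined by its values on \<open>D\<close>:
    \<open>x\<close> gives the values on \<open>X\<close>, and then \<open>z\<close> gives the value at \<open>y\<close>.\<close>
  define D where "D = insert x (V - insert y X)"
  have fD: "finite D" "D \<subseteq> V" using V X(1) x by (auto simp: D_def)
  have "insert y X \<subseteq> V" using X Y y by auto
  then have "card (V - insert y X) = card V - Suc (Suc m)" "Suc (Suc m) \<le> card V"
    using card_mono[OF V \<open>insert y X \<subseteq> V\<close>] fin(1) X(2) y(2) by (auto simp: card_Diff_subset)
  then have cD: "card D = card V - Suc m"
    using V x by (simp add: D_def)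
  have "inj_on (\<lambda>c. restrict c D) (monochromatic V C X \<inter> monochromatic V C Y)"
  proof (rule inj_onI)
    fix c d
    assume c: "c \<in> monochromatic V C X \<inter> monochromatic V C Y"
      and d: "d \<in> monochromatic V C X \<inter> monochromatic V C Y"
      and eq: "restrict c D = restrict d D"
    have onD: "c v = d v" if "v \<in> D" for v
      using fun_cong[OF eq, of v] that by simp
    have onX: "c v = d v" if "v \<in> X" for v
    proof -
      have "c v = c x" "d v = d x" using c d x that unfolding monochromatic_def by blast+
      then show ?thesis using onD[of x] by (simp add: D_def)
    qed
    \<comment> \<open>Covers disjoint \<open>X\<close> and \<open>Y\<close> too: if \<open>z\<close>
      is not in \<open>X\<close>, then it is in \<open>D\<close>, because it differs from
      \<open>y\<close>.\<close>
    have "c z = d z" using onX onD z Y(1) by (cases "z \<in> X") (auto simp: D_def)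
    moreover have "c y = c z" "d y = d z"
      using c d y(1) z(1) unfolding monochromatic_def by blast+
    ultimately have "c y = d y" by simp
    then have "c v = d v" if "v \<in> V" for v
      using onX onD that unfolding D_def by blast
    moreover have "c \<in> V \<rightarrow>\<^sub>E C" "d \<in> V \<rightarrow>\<^sub>E C" using c d by (auto simp: monochromatic_def)
    ultimately show "c = d" by (intro PiE_ext[of c V "\<lambda>_. C" d]) auto
  qed
  moreover have "(\<lambda>c. restrict c D) ` (monochromatic V C X \<inter> monochromatic V C Y) \<subseteq> D \<rightarrow>\<^sub>E C"
    using fD(2) by (auto simp: monochromatic_def PiE_iff)
  ultimately have "card (monochromatic V C X \<inter> monochromatic V C Y) \<le> card (D \<rightarrow>\<^sub>E C)"
    using fD(1) C by (intro card_inj_on_le[of "\<lambda>c. restrict c D"]) (auto intro: finite_PiE)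
  then show ?thesis using fD(1) cD by (simp add: card_PiE)
qed

section \<open>Monochromatic stars in a finite graph\<close>

text \<open>Stars are vertex sets that forget their centre: being monochromatic depends on the set
  alone, so distinct indices give genuinely different constraints.\<close>

definition stars :: "nat \<Rightarrow> ('a, 'b) pre_digraph \<Rightarrow> 'a set set" where
  "stars m G = (\<lambda>(v, S). insert v S) ` (SIGMA v:verts G. {S. S \<subseteq> neighbours G v \<and> card S = m})"

context graph
begin

lemma finite_neighbours: "finite (neighbours G v)"
  by (simp add: neighbours_def)

lemma not_self_neighbour: "v \<notin> neighbours G v"
  using no_loops by (auto simp: neighbours_def arcs_ends_conv)

lemma neighbours_sym: "w \<in> neighbours G v \<Longrightarrow> v \<in> neighbours G w"
  using sym_arcs by (auto simp: neighbours_def symmetric_def sym_def)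

lemma starsE:
  assumes "X \<in> stars m G"
  obtains v S where "v \<in> verts G" "S \<subseteq> neighbours G v" "card S = m" "X = insert v S"
  using assms by (auto simp: stars_def)

lemma stars_subset_verts: "X \<in> stars m G \<Longrightarrow> X \<subseteq> verts G"
  by (auto simp: stars_def neighbours_def)

lemma finite_stars: "finite (stars m G)"
  by (rule finite_subset[of _ "Pow (verts G)"]) (use stars_subset_verts in auto)

lemma card_star:
  assumes "X \<in> stars m G"
  shows "card X = Suc m"
proof -
  obtain v S where "S \<subseteq> neighbours G v" "card S = m" "X = insert v S"
    using assms by (rule starsE)
  moreover from this have "finite S" "v \<notin> S"
    using finite_neighbours not_self_neighbour by (auto intro: finite_subset)
  ultimately show ?thesis by simp
qed

text \<open>A vertex with at least m neighbours of its own colour forms a monochromatic star with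
  any m of them; conversely, the leaves of such a star are m neighbours coloured like its
  centre.\<close>

lemma degree_colourings_eq:
  "degree_colourings m G k =
     (verts G \<rightarrow>\<^sub>E {1..k}) - (\<Union>X\<in>stars m G. monochromatic (verts G) {1..k} X)"
proof -
  have "(\<exists>v\<in>verts G. m \<le> card {w \<in> neighbours G v. c w = c v}) \<longleftrightarrow>
      (\<exists>X\<in>stars m G. \<forall>x\<in>X. \<forall>y\<in>X. c x = c y)" for c :: "'a \<Rightarrow> nat"
  proof
    assume "\<exists>v\<in>verts G. m \<le> card {w \<in> neighbours G v. c w = c v}"
    then obtain v where v: "v \<in> verts G" "m \<le> card {w \<in> neighbours G v. c w = c v}" by blast
    from v(2) obtain S where "S \<subseteq> {w \<in> neighbours G v. c w = c v}" "card S = m"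
      using obtain_subset_with_card_n by blast
    then have "S \<subseteq> neighbours G v" "card S = m" and const: "\<forall>x\<in>S. c x = c v" by auto
    with v(1) have "insert v S \<in> stars m G"
      by (auto simp: stars_def intro!: image_eqI[of _ _ "(v, S)"])
    moreover have "\<forall>x\<in>insert v S. \<forall>y\<in>insert v S. c x = c y" using const by simp
    ultimately show "\<exists>X\<in>stars m G. \<forall>x\<in>X. \<forall>y\<in>X. c x = c y" by blast
  next
    assume "\<exists>X\<in>stars m G. \<forall>x\<in>X. \<forall>y\<in>X. c x = c y"
    then obtain X where X: "X \<in> stars m G" "\<forall>x\<in>X. \<forall>y\<in>X. c x = c y" by blast
    obtain v S where S: "v \<in> verts G" "S \<subseteq> neighbours G v" "card S = m" "X = insert v S"
      using X(1) by (rule starsE)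
    have "S \<subseteq> {w \<in> neighbours G v. c w = c v}" using S X(2) by auto
    then have "m \<le> card {w \<in> neighbours G v. c w = c v}"
      using S(3) finite_neighbours card_mono[of "{w \<in> neighbours G v. c w = c v}" S] by auto
    then show "\<exists>v\<in>verts G. m \<le> card {w \<in> neighbours G v. c w = c v}" using S(1) by blast
  qed
  then show ?thesis unfolding degree_colourings_def monochromatic_def by blast
qed

text \<open>The centre can be recovered from the set. Two different centres of one set would be
  leaves of each other, and m > 1 leaves a third vertex adjacent to both, which closes a
  triangle.\<close>

lemma card_stars:
  assumes "1 < m"
    and no_triangle: "\<And>u v w. v \<in> neighbours G u \<Longrightarrow> w \<in> neighbours G v \<Longrightarrow> u \<notin> neighbours G w"
  shows "card (stars m G) = (\<Sum>v\<in>verts G. degree G v choose m)"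
proof -
  have "inj_on (\<lambda>(v, S). insert v S) (SIGMA v:verts G. {S. S \<subseteq> neighbours G v \<and> card S = m})"
  proof (rule inj_onI, clarify)
    fix v S w R
    assume S: "S \<subseteq> neighbours G v" "m = card S" and R: "R \<subseteq> neighbours G w" "card R = card S"
      and eq: "insert v S = insert w R"
    have notin: "v \<notin> S" "w \<notin> R" using S R not_self_neighbour by auto
    have "v = w"
    proof (rule ccontr)
      assume "v \<noteq> w"
      then have "w \<in> S" "v \<in> R" using eq by auto
      have "finite S" using S \<open>1 < m\<close> card_ge_0_finite by force
      then obtain x where x: "x \<in> S" "x \<noteq> w"
        using card_le_Suc0_iff_eq[of S] S(2) \<open>1 < m\<close> \<open>w \<in> S\<close> by auto
      then have "x \<in> R" using eq by auto
      then show False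
        using no_triangle[of w v x] neighbours_sym S R x \<open>w \<in> S\<close> by blast
    qed
    then show "v = w \<and> S = R" using eq notin by (simp add: insert_ident)
  qed
  moreover have "finite {S. S \<subseteq> neighbours G v \<and> card S = m}" for v
    using finite_neighbours by simp
  ultimately show ?thesis
    by (simp add: stars_def card_image n_subsets[OF finite_neighbours] degree_def)
qed

text \<open>The union bound and the Bonferroni bound on the number of bad colourings, moved to the
  complement. The additive form avoids truncated subtraction of counts.\<close>

lemma degree_chromatic_bounds:
  fixes k m :: nat
  assumes "0 < m"
  defines "n \<equiv> card (verts G)" and "s \<equiv> card (stars m G)"
  shows "k ^ n \<le> degree_chromatic m G k + s * k ^ (n - m)"
    and "degree_chromatic m G k + s * k ^ (n - m) \<le> k ^ n + s\<^sup>2 * k ^ (n - Suc m)"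
proof -
  let ?A = "monochromatic (verts G) {1..k}"
  let ?U = "\<Union>X\<in>stars m G. ?A X"
  have sub: "?U \<subseteq> verts G \<rightarrow>\<^sub>E {1..k}" by (auto simp: monochromatic_def)
  have fin: "finite (verts G \<rightarrow>\<^sub>E {1..k})" by (intro finite_PiE) auto
  have "card (verts G \<rightarrow>\<^sub>E {1..k}) = k ^ n" by (simp add: card_PiE n_def)
  then have total: "degree_chromatic m G k + card ?U = k ^ n"
    unfolding degree_chromatic_def degree_colourings_eq
    using card_Diff_subset[OF finite_subset[OF sub fin] sub] card_mono[OF fin sub] by simp
  have sum: "(\<Sum>X\<in>stars m G. card (?A X)) = s * k ^ (n - m)"
    using card_monochromatic[OF finite_verts stars_subset_verts card_star, where C = "{1..k}"]
    by (simp add: s_def n_def)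
  have "card ?U \<le> s * k ^ (n - m)"
    using card_UN_le[OF finite_stars, of ?A m] sum by simp
  then show "k ^ n \<le> degree_chromatic m G k + s * k ^ (n - m)" using total by linarith
  have "card (?A X \<inter> ?A Y) \<le> k ^ (n - Suc m)"
    if "X \<in> stars m G" "Y \<in> stars m G" "X \<noteq> Y" for X Y
    using card_monochromatic_Int_le[of "verts G" "{1..k}" X m Y] that assms(1)
      stars_subset_verts card_star by (simp add: n_def)
  then have "(\<Sum>X\<in>stars m G. card (?A X)) \<le> card ?U + s\<^sup>2 * k ^ (n - Suc m)"
    unfolding s_def
    by (intro sum_card_le_card_UN finite_stars) (auto intro: finite_monochromatic)
  then show "degree_chromatic m G k + s * k ^ (n - m) \<le> k ^ n + s\<^sup>2 * k ^ (n - Suc m)"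
    using sum total by linarith
qed

end

section \<open>Trees and the asymptotic estimate\<close>

text \<open>The three arcs of a triangle form a cycle of length exactly 3, the shortest length that
  \<open>undirected_tree\<close> forbids.\<close>

lemma undirected_tree_no_triangle:
  assumes T: "undirected_tree T"
    and uv: "v \<in> neighbours T u" and vw: "w \<in> neighbours T v"
  shows "u \<notin> neighbours T w"
proof
  assume wu: "u \<in> neighbours T w"
  interpret graph T using T by (simp add: undirected_tree_def)
  obtain a b c where arcs: "a \<in> arcs T" "b \<in> arcs T" "c \<in> arcs T"
    and ends: "tail T a = u" "head T a = v" "tail T b = v" "head T b = w"
      "tail T c = w" "head T c = u"
    using uv vw wu by (auto simp: neighbours_def arcs_ends_conv)
  have "distinct [u, v, w]" using uv vw wu not_self_neighbour by auto
  moreover have "awalk u [a, b, c] u"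
    using arcs ends by (auto simp: awalk_Cons_iff awalk_Nil_iff)
  ultimately have "cycle [a, b, c]" using ends by (auto simp: cycle_def)
  then show False using T by (auto simp: undirected_tree_def dest!: spec[of _ "[a, b, c]"])
qed

theorem theorem1:
  fixes T :: "('a, 'b) pre_digraph" and n m :: nat
  assumes "undirected_tree T"
    and "n = card (verts T)"
    and "1 < m" and "m < n"
  shows "(\<lambda>k. real (degree_chromatic m T k)
              - (real k ^ n - (\<Sum>v\<in>verts T. real (degree T v choose m) * real k ^ (n - m))))
         \<in> o[at_top](\<lambda>k. real k ^ (n - m))"
proof -
  interpret graph T using assms(1) by (simp add: undirected_tree_def)
  define s where "s = card (stars m T)"
  have "s = (\<Sum>v\<in>verts T. degree T v choose m)"
    unfolding s_def using assms(3) undirected_tree_no_triangle[OF assms(1)] by (rule card_stars)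
  then have s: "(\<Sum>v\<in>verts T. real (degree T v choose m) * real k ^ (n - m)) =
      real (s * k ^ (n - m))" for k
    by (simp add: sum_distrib_right)
  \<comment> \<open>The two bounds place the difference between 0 and
    \<open>s\<^sup>2 * k ^ (n - Suc m)\<close>, where \<open>s\<close> does not depend on
    \<open>k\<close>.\<close>
  have "norm (real (degree_chromatic m T k)
      - (real k ^ n - (\<Sum>v\<in>verts T. real (degree T v choose m) * real k ^ (n - m))))
      \<le> real (s\<^sup>2) * norm (real k ^ (n - Suc m))" for k
  proof -
    have "real (k ^ n) \<le> real (degree_chromatic m T k + s * k ^ (n - m))"
      "real (degree_chromatic m T k + s * k ^ (n - m)) \<le> real (k ^ n + s\<^sup>2 * k ^ (n - Suc m))"
      using degree_chromatic_bounds[of m k] assms(2,3)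
      unfolding s_def of_nat_le_iff by auto
    then show ?thesis unfolding s by simp
  qed
  then have "(\<lambda>k. real (degree_chromatic m T k)
      - (real k ^ n - (\<Sum>v\<in>verts T. real (degree T v choose m) * real k ^ (n - m))))
      \<in> O[at_top](\<lambda>k. real k ^ (n - Suc m))"
    by (intro bigoI[where c = "real (s\<^sup>2)"] always_eventually allI)
  also have "(\<lambda>k. real k ^ (n - Suc m)) \<in> o[at_top](\<lambda>k. real k ^ (n - m))"
  proof (rule smalloI_tendsto)
    \<comment> \<open>Since m < n, the exponents differ by exactly one; for m = n truncation would
      make both 0.\<close>
    have "real k ^ (n - Suc m) / real k ^ (n - m) = inverse (real k)" if "0 < k" for k
      using that assms(4) by (simp add: Suc_diff_Suc[symmetric] field_simps)
    then have "eventually (\<lambda>k. inverse (real k) = real k ^ (n - Suc m) / real k ^ (n - m)) at_top"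
      by (intro eventually_mono[OF eventually_gt_at_top[of 0]]) simp
    then show "((\<lambda>k. real k ^ (n - Suc m) / real k ^ (n - m)) \<longlongrightarrow> 0) at_top"
      using lim_inverse_n by (rule Lim_transform_eventually[rotated])
    show "eventually (\<lambda>k. real k ^ (n - m) \<noteq> 0) at_top"
      using eventually_gt_at_top[of 0] by eventually_elim simp
  qed
  finally show ?thesis .
qed

end
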